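(* Let $G=(V,E)$ be a $\delta$-regular equatorial graph with girth $4$ and equator $q$. Then $q\equiv 0\pmod 4$ or $\delta\equiv 0\pmod 2$. Moreover, $V$ can be partitioned into $q$ independent sets $L_0,\dots,L_{q-1}$ such that $E$ consists exactly of all edges $uv$ with $u\in L_i$, $v\in L_{i+1}$ (indices mod $q$). Furthermore: if $q\equiv0\pmod4$, there are positive integers $n_0,n_1,n_2,n_3$ with $n_0+n_2=\delta=n_1+n_3$ and $|L_i|=n_j$ whenever $i\equiv j\pmod 4$; if $q\not\equiv0\pmod4$, then $|L_i|=\frac{\delta}{2}$ for all $i$.
   Context: A cycle $C$ in $G$ is isometric if $d_C(x,y)=d_G(x,y)$ for all $x,y\in V(C)$; the equator is the length of a longest isometric cycle. For $\delta\ge2$, $g\ge3$, $k=\lceil g/2\rceil-1$, the Moore bound is $M(\delta,g)=1+\sum_{i=0}^{k-1}\delta(\delta-1)^i$ for odd $g$ and $M(\delta,g)=2+\sum_{i=1}^{k}2(\delta-1)^i$ for even $g$ (so $M(\delta,4)=2\delta$). An equatorial graph is a finite graph with girth $g$, minimum degree $\delta$ and equator $q>6k+3$ whose order is exactly $\frac{q}{g}M(\delta,g)$; for $g=4$ this means $q>9$ and order $\frac{q\delta}{2}$. *)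

theory Defs
  imports
    Graph_Theory.Pair_Digraph
    Graph_Theory.Shortest_Path
    "HOL-Library.Extended_Nat"
    "HOL-Library.Disjoint_Sets"
begin

text \<open>
  A finite simple graph is a \<open>pair_graph\<close>: a finite loop-free digraph whose arc set
  \<open>parcs G\<close> is symmetric. An undirected edge \<open>uv\<close> is the pair of arcs \<open>(u, v)\<close>, \<open>(v, u)\<close>,
  so the degree of a vertex is its \<open>out_degree\<close>.
\<close>

definition graph_dist :: "'a pair_pre_digraph \<Rightarrow> 'a \<Rightarrow> 'a \<Rightarrow> ereal" where
  "graph_dist G u v = wf_digraph.\<mu> (with_proj G) (\<lambda>_. 1) u v"

text \<open>
  The library's \<open>cycle\<close> also admits the closed walk \<open>u, v, u\<close> along a single edge; the
  length restriction excludes it.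
\<close>

definition graph_cycle :: "'a pair_pre_digraph \<Rightarrow> ('a \<times> 'a) list \<Rightarrow> bool" where
  "graph_cycle G p \<longleftrightarrow> pre_digraph.cycle (with_proj G) p \<and> 3 \<le> length p"

text \<open>The subgraph consisting of the vertices and edges traversed by the cycle \<open>p\<close>.\<close>

definition cycle_subgraph :: "('a \<times> 'a) list \<Rightarrow> 'a pair_pre_digraph" where
  "cycle_subgraph p = \<lparr> pverts = fst ` set p, parcs = set p \<union> (set p)\<inverse> \<rparr>"

definition isometric_cycle :: "'a pair_pre_digraph \<Rightarrow> ('a \<times> 'a) list \<Rightarrow> bool" where
  "isometric_cycle G p \<longleftrightarrow> graph_cycle G p \<and>
     (\<forall>x \<in> pverts (cycle_subgraph p). \<forall>y \<in> pverts (cycle_subgraph p).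
        graph_dist (cycle_subgraph p) x y = graph_dist G x y)"

text \<open>The girth of an acyclic graph is \<open>\<infinity>\<close>, and its equator is 0.\<close>

definition girth :: "'a pair_pre_digraph \<Rightarrow> enat" where
  "girth G = (INF p \<in> {p. graph_cycle G p}. enat (length p))"

definition equator :: "'a pair_pre_digraph \<Rightarrow> enat" where
  "equator G = (SUP p \<in> {p. isometric_cycle G p}. enat (length p))"

definition min_degree :: "'a pair_pre_digraph \<Rightarrow> nat" where
  "min_degree G = Min (out_degree (with_proj G) ` pverts G)"

definition regular_graph :: "'a pair_pre_digraph \<Rightarrow> nat \<Rightarrow> bool" where
  "regular_graph G d \<longleftrightarrow> (\<forall>v \<in> pverts G. out_degree (with_proj G) v = d)"

definition independent_set :: "'a pair_pre_digraph \<Rightarrow> 'a set \<Rightarrow> bool" where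
  "independent_set G S \<longleftrightarrow> S \<subseteq> pverts G \<and> (\<forall>u \<in> S. \<forall>v \<in> S. (u, v) \<notin> parcs G)"

definition moore_radius :: "nat \<Rightarrow> nat" where
  "moore_radius g = nat \<lceil>real g / 2\<rceil> - 1"

text \<open>
  The truncated subtractions in \<open>moore_radius\<close> and \<open>moore_bound\<close> are exact in the
  intended range \<open>d \<ge> 2\<close>, \<open>g \<ge> 3\<close>.
\<close>

definition moore_bound :: "nat \<Rightarrow> nat \<Rightarrow> nat" where
  "moore_bound d g =
     (if odd g then 1 + (\<Sum>i < moore_radius g. d * (d - 1) ^ i)
      else 2 + (\<Sum>i = 1..moore_radius g. 2 * (d - 1) ^ i))"

definition equatorial_graph ::
  "'a pair_pre_digraph \<Rightarrow> nat \<Rightarrow> nat \<Rightarrow> nat \<Rightarrow> bool" where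
  "equatorial_graph G d g q \<longleftrightarrow>
     pair_graph G \<and> 2 \<le> d \<and> 3 \<le> g \<and>
     girth G = enat g \<and> min_degree G = d \<and> equator G = enat q \<and>
     6 * moore_radius g + 3 < q \<and>
     real (card (pverts G)) = real q / real g * real (moore_bound d g)"

end

(*
  Let c be an isometric cycle of length q. Two cycle vertices with a common neighbour are at
  distance 0 or 2 on c, so a vertex has at most two neighbours on c. Counting the edges
  between c and V gives q \<delta> = 2 |V|, so each vertex has exactly two, c (i - 1) and c (i + 1)
  for a unique i mod q; this i is its layer. Edges close up to walks of length 3 between
  cycle vertices, which forces them to join consecutive layers. Regularity then makes the
  neighbourhood of a vertex of layer i the whole of the layers i - 1 and i + 1, whence
  |L_i| + |L_(i+2)| = \<delta> and |L_i| = |L_(i+4)|.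
*)
theory Submission
  imports Defs
begin

section \<open>Distances and cycles\<close>

lemma graph_dist_le_relpow:
  assumes "pair_wf_digraph G" "u \<in> pverts G" "(u, v) \<in> parcs G ^^ n"
  shows "graph_dist G u v \<le> ereal (real n)"
proof -
  interpret pair_wf_digraph G by fact
  have "\<exists>p. awalk u p v \<and> length p = n"
    using assms(2,3)
  proof (induction n arbitrary: u)
    case 0
    then show ?case by (auto simp: awalk_Nil_iff)
  next
    case (Suc n)
    then obtain w where w: "(u, w) \<in> parcs G" "(w, v) \<in> parcs G ^^ n"
      by (meson relpow_Suc_D2)
    with Suc.IH obtain p where "awalk w p v" "length p = n"
      using in_arcsD2 by blast
    with w Suc.prems have "awalk u ((u, w) # p) v \<and> length ((u, w) # p) = Suc n"
      by (auto simp: awalk_Cons_iff)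
    then show ?case by blast
  qed
  then obtain p where p: "awalk u p v" "length p = n" by blast
  have "awalk_cost (\<lambda>_. 1) p = real (length p)"
    by (induction p) auto
  then show ?thesis
    using min_cost_le_walk_cost[OF p(1), of "\<lambda>_. 1"] p(2) by (simp add: graph_dist_def)
qed

lemma graph_dist_leD:
  assumes "pair_wf_digraph G" "graph_dist G u v \<le> ereal (real n)"
  shows "\<exists>m\<le>n. (u, v) \<in> parcs G ^^ m"
proof -
  interpret pair_wf_digraph G by fact
  have cost: "awalk_cost (\<lambda>_. 1) p = real (length p)" for p :: "('a \<times> 'a) list"
    by (induction p) auto
  \<comment> \<open>The distance is an infimum over walks, and a strict bound on it yields a
    witness. As lengths are integers, shorter than \<open>Suc n\<close> means at most
    \<open>n\<close>.\<close>
  have "graph_dist G u v < ereal (real (Suc n))"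
    using assms(2) by (rule le_less_trans) simp
  then obtain p where p: "awalk u p v" "length p < Suc n"
    unfolding graph_dist_def \<mu>_def by (auto simp: INF_less_iff cost)
  have "(u, v) \<in> parcs G ^^ length p"
    using p(1)
  proof (induction p arbitrary: u)
    case Nil
    then show ?case by (simp add: awalk_Nil_iff)
  next
    case (Cons e p)
    then have "(u, snd e) \<in> parcs G" "(snd e, v) \<in> parcs G ^^ length p"
      by (auto simp: awalk_Cons_iff)
    then show ?case unfolding length_Cons by (rule relpow_Suc_I2)
  qed
  with p(2) show ?thesis by (intro exI[of _ "length p"]) simp
qed

section \<open>Vertices of a cycle indexed by the integers modulo its length\<close>

text \<open>All integers serve as indices, so \<open>i - 1\<close> and \<open>i + 1\<close> need no
  wrap-around case and equality of vertices becomes divisibility of index differences.\<close>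

definition cycle_vertex :: "('a \<times> 'a) list \<Rightarrow> int \<Rightarrow> 'a" where
  "cycle_vertex p i = fst (p ! nat (i mod int (length p)))"

lemma cycle_vertex_cong:
  "int (length p) dvd j - i \<Longrightarrow> cycle_vertex p i = cycle_vertex p j"
  by (simp add: cycle_vertex_def mod_eq_dvd_iff flip: dvd_minus_iff[of _ "j - i"])
    (metis minus_diff_eq mod_eq_dvd_iff)

lemma cycle_vertex_mod: "cycle_vertex p (i mod int (length p) + k) = cycle_vertex p (i + k)"
  by (rule cycle_vertex_cong) (simp add: dvd_minus_mod)

lemma pcas_snd_nth:
  assumes "pcas u p v" "i < length p"
  shows "snd (p ! i) = (if Suc i = length p then v else fst (p ! Suc i))"
  using assms
proof (induction u p v arbitrary: i rule: pcas.induct)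
  case (2 u e es v)
  then show ?case
    by (cases i; cases es) auto
qed simp

lemma pcas_nth_0: "pcas u p v \<Longrightarrow> p \<noteq> [] \<Longrightarrow> fst (p ! 0) = u"
  by (cases p) auto

text \<open>Turns the simplicity condition of \<open>cycle\<close>, which concerns the vertices
  visited after the start, into distinctness of the heads of the arcs.\<close>

lemma tl_pawalk_verts: "pcas u p v \<Longrightarrow> tl (pawalk_verts u p) = map snd p"
proof (induction u p v rule: pcas.induct)
  case (2 u e es v)
  then show ?case by (cases es) auto
qed simp

context
  fixes G :: "'a pair_pre_digraph" and p :: "('a \<times> 'a) list"
  assumes cyc: "graph_cycle G p"
begin

lemma graph_cycle_pcas: obtains u where "pcas u p u" "set p \<subseteq> parcs G" "distinct (map snd p)"
  using cyc
  by (auto simp: graph_cycle_def pre_digraph.cycle_def pre_digraph.awalk_def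
      cas_with_proj_eq awalk_verts_with_proj_eq tl_pawalk_verts)

lemma graph_cycle_length: "3 \<le> length p"
  using cyc by (simp add: graph_cycle_def)

lemma graph_cycle_nth:
  assumes "i < length p"
  shows "p ! i = (cycle_vertex p (int i), cycle_vertex p (int i + 1))"
proof -
  obtain u where u: "pcas u p u" by (rule graph_cycle_pcas)
  have [simp]: "nat (int i) = i" "nat (int i + 1) = Suc i" by auto
  have "snd (p ! i) = cycle_vertex p (int i + 1)"
  proof (cases "Suc i = length p")
    case True
    then have "int i + 1 = int (length p)" by simp
    then have "cycle_vertex p (int i + 1) = fst (p ! 0)"
      unfolding cycle_vertex_def by simp
    also have "\<dots> = u" using u assms by (intro pcas_nth_0) auto
    finally show ?thesis using pcas_snd_nth[OF u assms] True by simp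
  next
    case False
    then show ?thesis
      using pcas_snd_nth[OF u assms] assms by (simp add: cycle_vertex_def)
  qed
  then show ?thesis
    using assms by (simp add: cycle_vertex_def prod_eq_iff)
qed

lemma set_graph_cycle: "set p = range (\<lambda>i. (cycle_vertex p i, cycle_vertex p (i + 1)))"
proof -
  let ?n = "int (length p)"
  have "(cycle_vertex p i, cycle_vertex p (i + 1)) \<in> set p" for i
  proof -
    have n: "?n > 0" using graph_cycle_length by linarith
    let ?k = "nat (i mod ?n)"
    have k: "?k < length p" "int ?k = i mod ?n"
      using pos_mod_sign[OF n, of i] pos_mod_bound[OF n, of i] by linarith+
    have "cycle_vertex p i = cycle_vertex p (int ?k)"
      "cycle_vertex p (i + 1) = cycle_vertex p (int ?k + 1)"
      unfolding k(2) using cycle_vertex_mod[of p i 0] cycle_vertex_mod[of p i 1] by simp_all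
    then show ?thesis
      using graph_cycle_nth[OF k(1)] nth_mem[OF k(1)] by simp
  qed
  moreover have "e \<in> range (\<lambda>i. (cycle_vertex p i, cycle_vertex p (i + 1)))" if "e \<in> set p" for e
    using that graph_cycle_nth by (auto simp: in_set_conv_nth)
  ultimately show ?thesis by blast
qed

lemma cycle_vertex_eqD:
  assumes "cycle_vertex p i = cycle_vertex p j"
  shows "int (length p) dvd j - i"
proof -
  let ?n = "int (length p)"
  have n: "?n > 0" using graph_cycle_length by linarith
  have dist: "distinct (map snd p)" by (rule graph_cycle_pcas)
  \<comment> \<open>Distinctness is known for heads of arcs, whereas \<open>cycle_vertex\<close>
    reads tails: vertex \<open>i\<close> is the head of arc number \<open>i - 1\<close>.\<close>
  have snd_eq: "cycle_vertex p i = snd (p ! nat ((i - 1) mod ?n))" for i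
  proof -
    let ?k = "nat ((i - 1) mod ?n)"
    have k: "?k < length p" "int ?k = (i - 1) mod ?n"
      using pos_mod_sign[OF n, of "i - 1"] pos_mod_bound[OF n, of "i - 1"] by linarith+
    have "cycle_vertex p i = cycle_vertex p (int ?k + 1)"
      unfolding k(2) using cycle_vertex_mod[of p "i - 1" 1] by simp
    then show ?thesis using graph_cycle_nth[OF k(1)] by simp
  qed
  have "map snd p ! nat ((i - 1) mod ?n) = map snd p ! nat ((j - 1) mod ?n)"
    using assms n by (simp add: snd_eq nat_less_iff)
  then have "nat ((i - 1) mod ?n) = nat ((j - 1) mod ?n)"
    using n by (subst (asm) nth_eq_iff_index_eq[OF dist]) (simp_all add: nat_less_iff)
  then have "(j - 1) mod ?n = (i - 1) mod ?n"
    using n by (simp add: eq_nat_nat_iff)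
  then have "?n dvd (j - 1) - (i - 1)" by (simp only: mod_eq_dvd_iff)
  then show ?thesis by simp
qed

text \<open>Each arc of the cycle subgraph changes the index by 1 or -1; \<open>s\<close> is the net
  displacement of the walk.\<close>

lemma relpow_cycle_subgraph:
  assumes "(cycle_vertex p i, v) \<in> parcs (cycle_subgraph p) ^^ m"
  shows "\<exists>s. \<bar>s\<bar> \<le> int m \<and> v = cycle_vertex p (i + s)"
  using assms
proof (induction m arbitrary: v)
  case 0
  then show ?case by auto
next
  case (Suc m)
  then obtain w where w: "(cycle_vertex p i, w) \<in> parcs (cycle_subgraph p) ^^ m"
    "(w, v) \<in> parcs (cycle_subgraph p)"
    by auto
  from Suc.IH[OF w(1)] obtain s where s: "\<bar>s\<bar> \<le> int m" "w = cycle_vertex p (i + s)"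
    by blast
  from w(2) obtain j where
    "w = cycle_vertex p j \<and> v = cycle_vertex p (j + 1) \<or>
     w = cycle_vertex p (j + 1) \<and> v = cycle_vertex p j"
    by (auto simp: cycle_subgraph_def set_graph_cycle)
  then obtain t j' where t: "\<bar>t\<bar> = 1" "w = cycle_vertex p j'" "v = cycle_vertex p (j' + t)"
    by (metis abs_1 abs_minus_cancel add_diff_cancel_right' diff_conv_add_uminus)
  \<comment> \<open>The index \<open>j'\<close> read off the last arc agrees with
    \<open>i + s\<close> only modulo the length.\<close>
  have "int (length p) dvd (i + s + t) - (j' + t)"
    using cycle_vertex_eqD[of j' "i + s"] s(2) t(2) by simp
  then have "v = cycle_vertex p (i + (s + t))"
    unfolding t(3) by (simp add: cycle_vertex_cong add.assoc)
  then show ?case using s(1) t(1) by (intro exI[of _ "s + t"]) simp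
qed

end

section \<open>Consequences of isometry, equator and girth\<close>

text \<open>A walk in \<open>G\<close> bounds the distance in \<open>G\<close>, hence by isometry
  the distance along the cycle, where a walk that short can only shift the index by
  \<open>s\<close>. Isometry thereby becomes arithmetic modulo the length.\<close>

lemma isometric_cycle_relpow:
  assumes G: "pair_wf_digraph G" and iso: "isometric_cycle G p"
    and walk: "(cycle_vertex p i, cycle_vertex p j) \<in> parcs G ^^ n"
  shows "\<exists>s. \<bar>s\<bar> \<le> int n \<and> int (length p) dvd j - i - s"
proof -
  have cyc: "graph_cycle G p" using iso by (simp add: isometric_cycle_def)
  let ?C = "cycle_subgraph p"
  have verts: "pverts ?C = range (cycle_vertex p)"
    by (simp add: cycle_subgraph_def set_graph_cycle[OF cyc] image_image)
  have C: "pair_wf_digraph ?C"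
  proof
    fix e assume "e \<in> parcs ?C"
    then have "e \<in> set p \<union> (set p)\<inverse>" by (simp add: cycle_subgraph_def)
    then show "fst e \<in> pverts ?C" "snd e \<in> pverts ?C"
      by (auto simp: verts set_graph_cycle[OF cyc])
  qed
  have "cycle_vertex p i \<in> pverts G"
  proof -
    have "(cycle_vertex p i, cycle_vertex p (i + 1)) \<in> set p"
      by (simp add: set_graph_cycle[OF cyc])
    moreover have "set p \<subseteq> parcs G" by (rule graph_cycle_pcas[OF cyc])
    ultimately show ?thesis using pair_wf_digraph.in_arcsD1[OF G] by blast
  qed
  then have "graph_dist G (cycle_vertex p i) (cycle_vertex p j) \<le> ereal (real n)"
    using graph_dist_le_relpow[OF G _ walk] by blast
  then have "graph_dist ?C (cycle_vertex p i) (cycle_vertex p j) \<le> ereal (real n)"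
    using iso verts by (simp add: isometric_cycle_def)
  then obtain m where m: "m \<le> n" "(cycle_vertex p i, cycle_vertex p j) \<in> parcs ?C ^^ m"
    using graph_dist_leD[OF C] by blast
  from relpow_cycle_subgraph[OF cyc m(2)] obtain s
    where s: "\<bar>s\<bar> \<le> int m" "cycle_vertex p j = cycle_vertex p (i + s)" by blast
  have "int (length p) dvd j - i - s"
    using cycle_vertex_eqD[OF cyc s(2)[symmetric]] by (simp add: diff_diff_eq)
  with s(1) m(1) show ?thesis by (intro exI[of _ s]) simp
qed

text \<open>In \<open>enat\<close> the supremum of the empty set is 0 and that of an infinite set is
  infinity, so a positive finite supremum is a maximum.\<close>

lemma equator_attained:
  assumes "equator G = enat q" "0 < q"
  obtains p where "isometric_cycle G p" "length p = q"
proof -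
  let ?S = "(\<lambda>p. enat (length p)) ` {p. isometric_cycle G p}"
  have sup: "Sup ?S = enat q" using assms(1) by (simp add: equator_def)
  then have "?S \<noteq> {}" "finite ?S"
    using assms(2) by (auto simp: Sup_enat_def zero_enat_def split: if_splits)
  then have "Max ?S = enat q" using sup by (simp only: Sup_enat_def if_True if_False)
  then have "enat q \<in> ?S"
    using Max_in[OF \<open>finite ?S\<close> \<open>?S \<noteq> {}\<close>] by simp
  then show ?thesis using that by auto
qed

lemma triangle_free_of_girth_4:
  assumes "pair_graph G" "girth G = enat 4" "(u, v) \<in> parcs G" "(v, w) \<in> parcs G"
  shows "(w, u) \<notin> parcs G"
proof
  assume wu: "(w, u) \<in> parcs G"
  interpret pair_graph G by fact
  have "graph_cycle G [(u, v), (v, w), (w, u)]"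
    unfolding graph_cycle_def cycle_def awalk_def
    using assms(3,4) wu by (auto dest: in_arcsD1 no_loops')
  then have "girth G \<le> enat 3"
    unfolding girth_def by (intro INF_lower2[of "[(u, v), (v, w), (w, u)]"]) (auto simp: numeral_eq_Suc)
  with assms(2) show False by simp
qed

section \<open>The layer structure around an isometric cycle\<close>

text \<open>Here \<open>isometric\<close> is isometry in terms of index displacements, and
  \<open>card_V\<close> is the extremal order, which makes the count of edges at the cycle
  tight.\<close>

locale tight_isometric_cycle =
  fixes V :: "'a set" and E :: "'a rel" and c :: "int \<Rightarrow> 'a" and q \<delta> :: nat
  assumes finite_V: "finite V" and E_subset: "E \<subseteq> V \<times> V" and sym_E: "sym E"
    and triangle_free: "(u, v) \<in> E \<Longrightarrow> (v, w) \<in> E \<Longrightarrow> (w, u) \<notin> E"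
    and regular: "v \<in> V \<Longrightarrow> card (E `` {v}) = \<delta>"
    and c_periodic: "int q dvd j - i \<Longrightarrow> c i = c j"
    and c_edge: "(c i, c (i + 1)) \<in> E"
    and isometric: "(c i, c j) \<in> E ^^ n \<Longrightarrow> \<exists>s. \<bar>s\<bar> \<le> int n \<and> int q dvd j - i - s"
    and q_ge: "10 \<le> q"
    and card_V: "2 * card V = q * \<delta>"
begin

text \<open>The vertices that can take the place of \<open>c i\<close> between its two neighbours on
  the cycle.\<close>

definition layer :: "int \<Rightarrow> 'a set" where
  "layer i = {v. (v, c (i - 1)) \<in> E \<and> (v, c (i + 1)) \<in> E}"

lemma E_commute: "(u, v) \<in> E \<longleftrightarrow> (v, u) \<in> E"
  using sym_E by (auto dest: symD)

text \<open>Here the length of the cycle enters: congruences modulo \<open>q\<close> between small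
  displacements become equations. The displacements combined below never exceed 8 in absolute
  value.\<close>

lemma small_dvd: "int q dvd m \<Longrightarrow> \<bar>m\<bar> < 10 \<Longrightarrow> m = 0"
  using q_ge zdvd_imp_le[of "int q" "\<bar>m\<bar>"] by fastforce

lemma c_in_V: "c i \<in> V"
  using c_edge E_subset by blast

lemma c_in_layer: "c i \<in> layer i"
  using c_edge[of "i - 1"] c_edge[of i] by (simp add: layer_def E_commute)

lemma layer_subset_V: "layer i \<subseteq> V"
  using E_subset by (auto simp: layer_def)

lemma layer_cong:
  assumes "int q dvd j - i"
  shows "layer i = layer j"
proof -
  have "c (i - 1) = c (j - 1)" "c (i + 1) = c (j + 1)"
    by (rule c_periodic, use assms in simp)+
  then show ?thesis by (simp add: layer_def)
qed

text \<open>The walk through \<open>v\<close> has length 2, so the displacement is at most 2 in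
  absolute value. Displacement 1 or -1 would make \<open>v\<close> and two consecutive cycle
  vertices a triangle.\<close>

lemma common_neighbour:
  assumes "(v, c i) \<in> E" "(v, c j) \<in> E"
  shows "\<exists>s\<in>{-2, 0, 2}. int q dvd j - i - s"
proof -
  have "(c i, c j) \<in> E ^^ 2"
    using assms by (auto simp: numeral_2_eq_2 E_commute)
  then obtain s where s: "\<bar>s\<bar> \<le> 2" "int q dvd j - i - s"
    using isometric by fastforce
  have "s \<noteq> 1"
  proof
    assume "s = 1"
    then have "c j = c (i + 1)"
      using s(2) c_periodic[of j "i + 1"] c_periodic[of "i + 1" j] by (simp add: algebra_simps)
    then show False
      using triangle_free[of v "c i" "c (i + 1)"] assms c_edge E_commute by metis
  qed
  moreover have "s \<noteq> -1"
  proof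
    assume "s = -1"
    then have "c (j + 1) = c i"
      using s(2) c_periodic[of i "j + 1"] by (simp add: algebra_simps dvd_diff_commute)
    then show False
      using triangle_free[of v "c j" "c (j + 1)"] assms c_edge E_commute by metis
  qed
  ultimately have "s \<in> {-2, 0, 2}" using s(1) by auto
  with s(2) show ?thesis by blast
qed

section \<open>Counting the edges between the cycle and the vertex set\<close>

definition cycle_nbrs :: "'a \<Rightarrow> int set" where
  "cycle_nbrs v = {i \<in> {0..<int q}. (v, c i) \<in> E}"

lemma cycle_nbrs_eqI:
  "i \<in> cycle_nbrs v \<Longrightarrow> j \<in> cycle_nbrs v \<Longrightarrow> int q dvd j - i \<Longrightarrow> i = j"
  using zdvd_imp_le[of "int q" "j - i"] zdvd_imp_le[of "int q" "i - j"]
  by (force simp: cycle_nbrs_def dvd_diff_commute)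

lemma cycle_nbrs_pair:
  assumes "i \<in> cycle_nbrs v" "j \<in> cycle_nbrs v" "i \<noteq> j"
  shows "int q dvd j - i - 2 \<or> int q dvd j - i + 2"
  using common_neighbour[of v i j] cycle_nbrs_eqI[of i v j] assms by (auto simp: cycle_nbrs_def)

text \<open>Three cycle neighbours would be pairwise displaced by 2 or -2. Displacements add up
  along \<open>i\<close>, \<open>j\<close>, \<open>k\<close>, but a sum of two such numbers is -4, 0
  or 4.\<close>

lemma card_cycle_nbrs_le: "card (cycle_nbrs v) \<le> 2"
proof (rule ccontr)
  assume "\<not> card (cycle_nbrs v) \<le> 2"
  then have "3 \<le> card (cycle_nbrs v)" by simp
  then obtain T where T: "T \<subseteq> cycle_nbrs v" "card T = 3"
    by (meson obtain_subset_with_card_n)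
  then obtain i j k where "T = {i, j, k}" "i \<noteq> j" "j \<noteq> k" "i \<noteq> k"
    by (metis card_3_iff)
  then have ijk: "i \<in> cycle_nbrs v" "j \<in> cycle_nbrs v" "k \<in> cycle_nbrs v" "i \<noteq> j" "j \<noteq> k" "i \<noteq> k"
    using T by auto
  obtain a where a: "a \<in> {-2, 2}" "int q dvd j - i - a"
    using cycle_nbrs_pair[of i v j] ijk by force
  obtain b where b: "b \<in> {-2, 2}" "int q dvd k - j - b"
    using cycle_nbrs_pair[of j v k] ijk by force
  obtain d where d: "d \<in> {-2, 2}" "int q dvd k - i - d"
    using cycle_nbrs_pair[of i v k] ijk by force
  have "int q dvd (j - i - a) + (k - j - b) - (k - i - d)"
    using dvd_diff[OF dvd_add[OF a(2) b(2)] d(2)] .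
  then have "int q dvd d - a - b" by (simp add: algebra_simps)
  then have "d - a - b = 0" using a b d by (intro small_dvd) auto
  with a b d show False by auto
qed

text \<open>Double counting: seen from the cycle, each of the \<open>q\<close> indices contributes
  the degree of \<open>c i\<close>.\<close>

lemma sum_card_cycle_nbrs: "(\<Sum>v\<in>V. card (cycle_nbrs v)) = q * \<delta>"
proof -
  have "(\<Sum>v\<in>V. card (cycle_nbrs v)) = (\<Sum>i\<in>{0..<int q}. card {v \<in> V. (v, c i) \<in> E})"
    unfolding cycle_nbrs_def using finite_V by (intro sum_multicount_gen) auto
  also have "\<dots> = (\<Sum>i\<in>{0..<int q}. \<delta>)"
  proof (rule sum.cong)
    fix i
    have "{v \<in> V. (v, c i) \<in> E} = E `` {c i}" using E_subset by (auto simp: E_commute)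
    then show "card {v \<in> V. (v, c i) \<in> E} = \<delta>" using regular[OF c_in_V] by simp
  qed simp
  finally show ?thesis by simp
qed

text \<open>Both bounds on the number of edges between the cycle and \<open>V\<close> agree.\<close>

lemma card_cycle_nbrs:
  assumes "v \<in> V"
  shows "card (cycle_nbrs v) = 2"
proof (rule ccontr)
  assume "card (cycle_nbrs v) \<noteq> 2"
  then have "card (cycle_nbrs v) < 2" using card_cycle_nbrs_le[of v] by simp
  then have "(\<Sum>v\<in>V. card (cycle_nbrs v)) < (\<Sum>v\<in>V. 2)"
    using assms card_cycle_nbrs_le finite_V by (intro sum_strict_mono_ex1) auto
  then show False using sum_card_cycle_nbrs card_V by simp
qed

section \<open>Layers: covering, disjointness and the edges between them\<close>

text \<open>The two cycle neighbours differ by 2 modulo \<open>q\<close>, and the index halfway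
  between them is the layer. The cases reflect which of them comes first.\<close>

lemma in_some_layer:
  assumes "v \<in> V"
  shows "\<exists>i. v \<in> layer i"
proof -
  obtain i j where ij: "cycle_nbrs v = {i, j}" "i \<noteq> j"
    using card_cycle_nbrs[OF assms] by (auto simp: card_2_iff)
  then have E: "(v, c i) \<in> E" "(v, c j) \<in> E" by (auto simp: cycle_nbrs_def)
  consider "int q dvd j - i - 2" | "int q dvd j - i + 2"
    using cycle_nbrs_pair[of i v j] ij by auto
  then show ?thesis
  proof cases
    case 1
    then have "c j = c (i + 1 + 1)" by (intro c_periodic[symmetric]) (simp add: algebra_simps)
    then have "v \<in> layer (i + 1)" using E by (simp add: layer_def)
    then show ?thesis ..
  next
    case 2
    then have "c i = c (j + 1 + 1)" by (intro c_periodic) (simp add: algebra_simps)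
    then have "v \<in> layer (j + 1)" using E by (simp add: layer_def)
    then show ?thesis ..
  qed
qed

text \<open>Comparing the cycle neighbours from both memberships gives a displacement
  \<open>r\<close> of \<open>j - i\<close> such that \<open>r\<close>, \<open>r + 2\<close> and
  \<open>r - 2\<close> all lie in {-2, 0, 2}; only \<open>r = 0\<close> remains.\<close>

lemma layer_disjoint:
  assumes "v \<in> layer i" "v \<in> layer j"
  shows "int q dvd j - i"
proof -
  have E: "(v, c (i - 1)) \<in> E" "(v, c (i + 1)) \<in> E" "(v, c (j - 1)) \<in> E" "(v, c (j + 1)) \<in> E"
    using assms by (auto simp: layer_def)
  have shift: "(j - 1) - (i - 1) = j - i" "(j + 1) - (i - 1) = j - i + 2"
    "(j - 1) - (i + 1) = j - i - 2"
    by simp_all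
  obtain r where r: "r \<in> {-2, 0, 2}" "int q dvd j - i - r"
    using common_neighbour[OF E(1,3)] unfolding shift by blast
  obtain s where s: "s \<in> {-2, 0, 2}" "int q dvd j - i + 2 - s"
    using common_neighbour[OF E(1,4)] unfolding shift by blast
  obtain t where t: "t \<in> {-2, 0, 2}" "int q dvd j - i - 2 - t"
    using common_neighbour[OF E(2,3)] unfolding shift by blast
  have "s - 2 - r = 0" "t + 2 - r = 0"
    using dvd_diff[OF r(2) s(2)] dvd_diff[OF r(2) t(2)] r(1) s(1) t(1)
    by (intro small_dvd; auto simp: algebra_simps)+
  then have "r = 0" using r(1) s(1) t(1) by auto
  with r(2) show ?thesis by simp
qed

text \<open>Cycle neighbours of \<open>u\<close> and \<open>v\<close> are joined by walks of length
  3 through the edge. Varying the ends bounds \<open>r\<close>, \<open>r + 2\<close> and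
  \<open>r - 2\<close> by 3 in absolute value, so \<open>r\<close> is -1, 0 or 1;
  \<open>r = 0\<close> would give \<open>u\<close> and \<open>v\<close> a common neighbour and thus
  a triangle.\<close>

lemma layer_edge:
  assumes "u \<in> layer i" "v \<in> layer j" "(u, v) \<in> E"
  shows "int q dvd j - i - 1 \<or> int q dvd j - i + 1"
proof -
  have walk: "\<exists>s. \<bar>s\<bar> \<le> 3 \<and> int q dvd (j + b) - (i + a) - s"
    if "a \<in> {-1, 1}" "b \<in> {-1, 1}" for a b
  proof -
    have "(c (i + a), u) \<in> E" "(v, c (j + b)) \<in> E"
      using that assms(1,2) E_commute by (auto simp: layer_def)
    then have "(c (i + a), c (j + b)) \<in> E ^^ 3"
      using assms(3) by (auto simp: numeral_3_eq_3)
    then show ?thesis using isometric by fastforce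
  qed
  obtain r where r: "\<bar>r\<bar> \<le> 3" "int q dvd j - i - r"
    using walk[of 1 1] by (auto simp: algebra_simps)
  obtain s where s: "\<bar>s\<bar> \<le> 3" "int q dvd j - i + 2 - s"
    using walk[of "-1" 1] by (auto simp: algebra_simps)
  obtain t where t: "\<bar>t\<bar> \<le> 3" "int q dvd j - i - 2 - t"
    using walk[of 1 "-1"] by (auto simp: algebra_simps)
  have "s - 2 - r = 0" "t + 2 - r = 0"
    using dvd_diff[OF r(2) s(2)] dvd_diff[OF r(2) t(2)] r(1) s(1) t(1)
    by (intro small_dvd; auto simp: algebra_simps)+
  then have "\<bar>r\<bar> \<le> 1" using s(1) t(1) by linarith
  moreover have "r \<noteq> 0"
  proof
    assume "r = 0"
    then have "v \<in> layer i" using assms(2) r(2) layer_cong by auto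
    then show False
      using assms(1,3) triangle_free[of u v "c (i + 1)"] E_commute by (auto simp: layer_def)
  qed
  ultimately have "r = 1 \<or> r = -1" by auto
  then show ?thesis using r(2) by auto
qed

lemma neighbours_subset:
  assumes "u \<in> layer i"
  shows "E `` {u} \<subseteq> layer (i - 1) \<union> layer (i + 1)"
proof
  fix v assume v: "v \<in> E `` {u}"
  then obtain j where j: "v \<in> layer j" using in_some_layer E_subset by blast
  consider "int q dvd j - i - 1" | "int q dvd j - i + 1"
    using layer_edge[OF assms j] v by auto
  then show "v \<in> layer (i - 1) \<union> layer (i + 1)"
  proof cases
    case 1
    then have "layer (i + 1) = layer j" by (intro layer_cong) (simp add: algebra_simps)
    with j show ?thesis by simp
  next
    case 2
    then have "layer (i - 1) = layer j" by (intro layer_cong) (simp add: algebra_simps)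
    with j show ?thesis by simp
  qed
qed

lemma neighbours_c: "E `` {c i} = layer (i - 1) \<union> layer (i + 1)"
proof (rule antisym[OF neighbours_subset[OF c_in_layer]])
  \<comment> \<open>This inclusion is the definition of a layer: \<open>c i\<close> is the upper
    cycle neighbour for layer \<open>i - 1\<close> and the lower one for layer
    \<open>i + 1\<close>.\<close>
  show "layer (i - 1) \<union> layer (i + 1) \<subseteq> E `` {c i}"
    by (auto simp: layer_def E_commute)
qed

text \<open>The neighbourhood of \<open>u\<close> lies in that of \<open>c i\<close>, and both have \<open>\<delta>\<close> elements.\<close>

lemma neighbours_layer:
  assumes "u \<in> layer i"
  shows "E `` {u} = layer (i - 1) \<union> layer (i + 1)"
proof (rule card_subset_eq[OF _ neighbours_subset[OF assms]])
  show "finite (layer (i - 1) \<union> layer (i + 1))"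
    using finite_V layer_subset_V finite_subset by blast
  show "card (E `` {u}) = card (layer (i - 1) \<union> layer (i + 1))"
    using regular layer_subset_V assms c_in_V by (metis neighbours_c subsetD)
qed

section \<open>Sizes of the layers\<close>

text \<open>The two layers are disjoint and together form the neighbourhood of
  \<open>c (i + 1)\<close>.\<close>

lemma card_layer_add: "card (layer i) + card (layer (i + 2)) = \<delta>"
proof -
  have "layer i \<inter> layer (i + 2) = {}"
    using layer_disjoint[of _ i "i + 2"] small_dvd[of 2] by fastforce
  moreover have "finite (layer j)" for j
    using finite_V layer_subset_V finite_subset by blast
  ultimately have "card (layer i) + card (layer (i + 2)) = card (layer i \<union> layer (i + 2))"
    by (simp add: card_Un_disjoint)
  also have "\<dots> = \<delta>"
    using neighbours_c[of "i + 1"] regular[OF c_in_V[of "i + 1"]] by (simp add: add.assoc)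
  finally show ?thesis .
qed

lemma card_layer_cong_4:
  assumes "4 dvd j - i"
  shows "card (layer i) = card (layer j)"
proof -
  \<comment> \<open>Layers \<open>i\<close> and \<open>i + 4\<close> both complement layer
    \<open>i + 2\<close> to \<delta>.\<close>
  have step: "card (layer (i + 4)) = card (layer i)" for i
    using card_layer_add[of i] card_layer_add[of "i + 2"] by (simp add: add.assoc)
  have up: "card (layer (i + 4 * int n)) = card (layer i)" for i n
  proof (induction n)
    case (Suc n)
    then show ?case using step[of "i + 4 * int n"] by (simp add: algebra_simps)
  qed simp
  obtain k where k: "j = i + 4 * k" using assms by (metis add.commute diff_add_cancel dvdE)
  \<comment> \<open>A negative multiple of 4 is handled by going upwards from \<open>j\<close> to
    \<open>i\<close>.\<close>
  show ?thesis
    using up[of i "nat k"] up[of j "nat (-k)"] k by (cases "k \<ge> 0") simp_all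
qed

lemma card_layer_half:
  assumes "q mod 4 \<noteq> 0"
  shows "2 * card (layer i) = \<delta>"
proof -
  \<comment> \<open>A multiple of \<open>q\<close> that is 2 modulo 4: shifting by it fixes every
    layer, yet gives the size of the layer two further on.\<close>
  define m where "m = (if even q then q else 2 * q)"
  have m: "q dvd m" "m mod 4 = 2" using assms by (auto simp: m_def) presburger+
  have "card (layer (i + int m)) = card (layer (i + 2))"
    using m(2) by (intro card_layer_cong_4) presburger
  moreover have "layer i = layer (i + int m)"
    using m(1) by (intro layer_cong) simp
  ultimately show ?thesis using card_layer_add[of i] by simp
qed

lemma card_layer_pos: "0 < card (layer i)"
  using c_in_layer[of i] finite_V layer_subset_V[of i] finite_subset card_gt_0_iff by blast

section \<open>The partition and the edge set\<close>

lemma layer_independent: "u \<in> layer i \<Longrightarrow> v \<in> layer i \<Longrightarrow> (u, v) \<notin> E"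
  using triangle_free[of u v "c (i + 1)"] E_commute by (auto simp: layer_def)

lemma Union_layers: "(\<Union>i<q. layer (int i)) = V"
proof
  show "(\<Union>i<q. layer (int i)) \<subseteq> V" using layer_subset_V by blast
  show "V \<subseteq> (\<Union>i<q. layer (int i))"
  proof
    fix v assume "v \<in> V"
    then obtain i where i: "v \<in> layer i" using in_some_layer by blast
    let ?k = "nat (i mod int q)"
    have k: "?k < q" "int ?k = i mod int q" using q_ge by (simp_all add: nat_less_iff)
    have "layer (int ?k) = layer i" unfolding k(2) by (rule layer_cong) simp
    with i k(1) show "v \<in> (\<Union>i<q. layer (int i))" by blast
  qed
qed

lemma layers_disjoint_family: "disjoint_family_on (\<lambda>i. layer (int i)) {..<q}"
proof -
  have "i = j" if "i < q" "j < q" "v \<in> layer (int i)" "v \<in> layer (int j)" for i j v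
  proof -
    have "int j mod int q = int i mod int q"
      using layer_disjoint[OF that(3,4)] by (simp only: mod_eq_dvd_iff)
    with that(1,2) show ?thesis by simp
  qed
  then show ?thesis unfolding disjoint_family_on_def by blast
qed

lemma layer_mod: "layer (int (i mod q)) = layer (int i)"
  by (rule layer_cong) (simp add: zmod_int)

text \<open>Edges join consecutive layers by \<open>layer_edge\<close>; conversely, consecutive
  layers are completely joined by \<open>neighbours_layer\<close>.\<close>

lemma edge_iff:
  "(u, v) \<in> E \<longleftrightarrow>
    (\<exists>i<q. (u \<in> layer (int i) \<and> v \<in> layer (int ((i + 1) mod q))) \<or>
            (v \<in> layer (int i) \<and> u \<in> layer (int ((i + 1) mod q))))"
proof -
  have fwd: "(u, v) \<in> E" if "u \<in> layer (int i)" "v \<in> layer (int i + 1)" for u v i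
    using neighbours_layer[OF that(1)] that(2) by blast
  have "\<exists>i<q. (u \<in> layer (int i) \<and> v \<in> layer (int i + 1)) \<or>
            (v \<in> layer (int i) \<and> u \<in> layer (int i + 1))" if E: "(u, v) \<in> E"
  proof -
    have "u \<in> V" "v \<in> V" using E E_subset by auto
    then obtain i j where i: "i < q" "u \<in> layer (int i)" and j: "j < q" "v \<in> layer (int j)"
      using Union_layers by blast
    consider "int q dvd int j - int i - 1" | "int q dvd int j - int i + 1"
      using layer_edge[OF i(2) j(2) E] by auto
    then show ?thesis
    proof cases
      case 1
      then have "layer (int i + 1) = layer (int j)" by (intro layer_cong) (simp add: algebra_simps)
      with i j show ?thesis by blast
    next
      case 2
      then have "layer (int i) = layer (int j + 1)" by (intro layer_cong) (simp add: algebra_simps)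
      with i j show ?thesis by blast
    qed
  qed
  moreover have "(u, v) \<in> E"
    if "u \<in> layer (int i) \<and> v \<in> layer (int i + 1) \<or> v \<in> layer (int i) \<and> u \<in> layer (int i + 1)" for i
    using that fwd[of u i v] fwd[of v i u] E_commute[of u v] by blast
  \<comment> \<open>Periodicity identifies the layer after \<open>q - 1\<close> with layer 0, so
    reducing the index changes nothing.\<close>
  moreover have "layer (int ((i + 1) mod q)) = layer (int i + 1)" for i
    using layer_mod[of "i + 1"] by (simp add: add.commute)
  ultimately show ?thesis by auto
qed

end

section \<open>Transfer to regular equatorial graphs of girth 4\<close>

theorem theorem30:
  fixes G :: "'a pair_pre_digraph" and \<delta> q :: nat
  assumes "equatorial_graph G \<delta> 4 q"
    and "regular_graph G \<delta>"
  shows "(q mod 4 = 0 \<or> \<delta> mod 2 = 0) \<and>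
    (\<exists>L :: nat \<Rightarrow> 'a set.
       (\<Union>i<q. L i) = pverts G \<and>
       disjoint_family_on L {..<q} \<and>
       (\<forall>i<q. L i \<noteq> {} \<and> independent_set G (L i)) \<and>
       (\<forall>u v. (u, v) \<in> parcs G \<longleftrightarrow>
          (\<exists>i<q. (u \<in> L i \<and> v \<in> L ((i + 1) mod q)) \<or>
                  (v \<in> L i \<and> u \<in> L ((i + 1) mod q)))) \<and>
       (q mod 4 = 0 \<longrightarrow>
          (\<exists>n0 n1 n2 n3 :: nat.
             0 < n0 \<and> 0 < n1 \<and> 0 < n2 \<and> 0 < n3 \<and>
             n0 + n2 = \<delta> \<and> n1 + n3 = \<delta> \<and>
             (\<forall>i<q. (i mod 4 = 0 \<longrightarrow> card (L i) = n0) \<and>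
                     (i mod 4 = 1 \<longrightarrow> card (L i) = n1) \<and>
                     (i mod 4 = 2 \<longrightarrow> card (L i) = n2) \<and>
                     (i mod 4 = 3 \<longrightarrow> card (L i) = n3)))) \<and>
       (q mod 4 \<noteq> 0 \<longrightarrow> (\<forall>i<q. real (card (L i)) = real \<delta> / 2)))"
proof -
  have G: "pair_graph G" and girth: "girth G = enat 4" and eq: "equator G = enat q"
    and q: "6 * moore_radius 4 + 3 < q" and d: "2 \<le> \<delta>"
    and ord: "real (card (pverts G)) = real q / 4 * real (moore_bound \<delta> 4)"
    using assms(1) by (auto simp: equatorial_graph_def)
  interpret pair_graph G by (rule G)
  \<comment> \<open>With k = 1 the bound 6k + 3 is 9, whence \<open>10 \<le> q\<close>.\<close>
  have radius: "moore_radius 4 = 1" by (simp add: moore_radius_def)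
  obtain p where p: "isometric_cycle G p" "length p = q"
    using equator_attained[OF eq] q by auto
  have cyc: "graph_cycle G p" using p(1) by (simp add: isometric_cycle_def)
  interpret tight_isometric_cycle "pverts G" "parcs G" "cycle_vertex p" q \<delta>
  proof
    show "finite (pverts G)" by (rule pair_finite_verts)
    show "parcs G \<subseteq> pverts G \<times> pverts G" using wellformed' by auto
    show "sym (parcs G)" by (auto intro: symI arcs_symmetric)
    show "(w, u) \<notin> parcs G" if "(u, v) \<in> parcs G" "(v, w) \<in> parcs G" for u v w
      using triangle_free_of_girth_4[OF G girth that] .
    show "card (parcs G `` {v}) = \<delta>" if "v \<in> pverts G" for v
    proof -
      have "out_arcs G v = Pair v ` (parcs G `` {v})" by (auto simp: out_arcs_def)
      then have "out_degree G v = card (parcs G `` {v})"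
        by (simp add: out_degree_def card_image inj_on_def)
      then show ?thesis using assms(2) that by (simp add: regular_graph_def)
    qed
    show "cycle_vertex p i = cycle_vertex p j" if "int q dvd j - i" for i j
      using that p(2) by (simp add: cycle_vertex_cong)
    show "(cycle_vertex p i, cycle_vertex p (i + 1)) \<in> parcs G" for i
    proof -
      have "set p \<subseteq> parcs G" by (rule graph_cycle_pcas[OF cyc])
      then show ?thesis by (auto simp: set_graph_cycle[OF cyc])
    qed
    show "\<exists>s. \<bar>s\<bar> \<le> int n \<and> int q dvd j - i - s"
      if "(cycle_vertex p i, cycle_vertex p j) \<in> parcs G ^^ n" for i j n
      using isometric_cycle_relpow[OF _ p(1) that] p(2) by blast
    show "10 \<le> q" using q radius by simp
    \<comment> \<open>The Moore bound is 2 + 2(\<delta> - 1) = 2\<delta>; the subtraction is exact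
      because \<open>2 \<le> \<delta>\<close>.\<close>
    have "real (2 * card (pverts G)) = real (q * \<delta>)"
      using ord d by (simp add: moore_bound_def radius algebra_simps)
    then show "2 * card (pverts G) = q * \<delta>" by (simp only: of_nat_eq_iff)
  qed
  let ?L = "\<lambda>i. layer (int i)"
  have parity: "q mod 4 = 0 \<or> \<delta> mod 2 = 0"
    using card_layer_half[of 0] by (metis mod_mult_self1_is_0)
  have indep: "\<forall>i<q. ?L i \<noteq> {} \<and> independent_set G (?L i)"
    using c_in_layer layer_independent layer_subset_V unfolding independent_set_def by blast
  have sizes: "\<exists>n0 n1 n2 n3 :: nat.
      0 < n0 \<and> 0 < n1 \<and> 0 < n2 \<and> 0 < n3 \<and> n0 + n2 = \<delta> \<and> n1 + n3 = \<delta> \<and>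
      (\<forall>i<q. (i mod 4 = 0 \<longrightarrow> card (?L i) = n0) \<and> (i mod 4 = 1 \<longrightarrow> card (?L i) = n1) \<and>
              (i mod 4 = 2 \<longrightarrow> card (?L i) = n2) \<and> (i mod 4 = 3 \<longrightarrow> card (?L i) = n3))"
  proof -
    \<comment> \<open>The witnesses will be the sizes of layers 0 to 3, each representing its
      residue class modulo 4.\<close>
    have mod4: "card (?L i) = card (layer (int r))" if "i mod 4 = r" for i r
      using that by (intro card_layer_cong_4) presburger
    have "0 < card (layer 0)" "0 < card (layer 1)" "0 < card (layer 2)" "0 < card (layer 3)"
      by (rule card_layer_pos)+
    moreover have "card (layer 0) + card (layer 2) = \<delta>" "card (layer 1) + card (layer 3) = \<delta>"
      using card_layer_add[of 0] card_layer_add[of 1] by simp_all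
    moreover have "(i mod 4 = 0 \<longrightarrow> card (?L i) = card (layer 0)) \<and>
        (i mod 4 = 1 \<longrightarrow> card (?L i) = card (layer 1)) \<and>
        (i mod 4 = 2 \<longrightarrow> card (?L i) = card (layer 2)) \<and>
        (i mod 4 = 3 \<longrightarrow> card (?L i) = card (layer 3))" for i
      using mod4[of i 0] mod4[of i 1] mod4[of i 2] mod4[of i 3] by simp
    ultimately show ?thesis
      by - (rule exI[of _ "card (layer 0)"], rule exI[of _ "card (layer 1)"],
          rule exI[of _ "card (layer 2)"], rule exI[of _ "card (layer 3)"], simp)
  qed
  have half: "q mod 4 \<noteq> 0 \<longrightarrow> (\<forall>i<q. real (card (?L i)) = real \<delta> / 2)"
  proof (intro impI allI)
    fix i assume "q mod 4 \<noteq> 0"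
    then have "\<delta> = 2 * card (?L i)" by (simp add: card_layer_half)
    then show "real (card (?L i)) = real \<delta> / 2" by simp
  qed
  show ?thesis
    using parity Union_layers layers_disjoint_family indep edge_iff sizes half
    by (intro conjI exI[of _ ?L]) (assumption | rule allI impI)+
qed

end
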